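(* Let $A$ be a $2\times 2$ matrix over $\mathbb{F}_2$ that admits a diagonal form over $\mathbb{F}_2$ (i.e. is similar over $\mathbb{F}_2$ to a diagonal matrix). Then $A$ is a square over $\mathbb{F}_2$, i.e. there is a $2\times 2$ matrix $B$ over $\mathbb{F}_2$ with $B^2=A$.
   Context: $\mathbb{F}_2$ is the field with two elements. *)

theory Defs
  imports "Jordan_Normal_Form.Matrix" "HOL-Library.Z2"
begin

end

theory Submission
  imports Defs
begin

text \<open>Every element of the two-element field is idempotent, hence so is every diagonal
  matrix over it, and idempotency is invariant under similarity. So \<open>A\<close> is its own square
  root.\<close>

lemma diagonal_mat_bit_idempotent:
  fixes D :: "bit mat"
  assumes D: "D \<in> carrier_mat n n" and diag: "diagonal_mat D"
  shows "D * D = D"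
proof (rule eq_matI)
  fix i j
  assume "i < dim_row D" "j < dim_col D"
  then have i: "i < n" and j: "j < n"
    using D by auto
  have "(D * D) $$ (i, j) = (\<Sum>k = 0..<n. D $$ (i, k) * D $$ (k, j))"
    using D i j by (simp add: scalar_prod_def)
  \<comment> \<open>Row \<open>i\<close> of the diagonal matrix \<open>D\<close> vanishes off column
    \<open>i\<close>, so only the term \<open>k = i\<close> survives.\<close>
  also have "\<dots> = (\<Sum>k = 0..<n. if k = i then D $$ (i, i) * D $$ (i, j) else 0)"
    using D diag i by (intro sum.cong) (auto simp: diagonal_mat_def)
  also have "\<dots> = D $$ (i, i) * D $$ (i, j)"
    using i by simp
  \<comment> \<open>For \<open>i = j\<close> this is \<open>x * x = x\<close>, which holds for both
    values of type \<open>bit\<close>; otherwise both sides are 0.\<close>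
  also have "\<dots> = D $$ (i, j)"
    using D diag i j by (cases "i = j") (auto simp: diagonal_mat_def)
  finally show "(D * D) $$ (i, j) = D $$ (i, j)" .
qed (use D in auto)

text \<open>Conjugation is multiplicative: if \<open>A = P * D * Q\<close> with \<open>P\<close>,
  \<open>Q\<close> mutually inverse, the inner \<open>Q * P\<close> cancels in
  \<open>A * A\<close>.\<close>

lemma similar_mat_idempotent:
  fixes A D :: "'a :: comm_ring_1 mat"
  assumes sim: "similar_mat A D" and idem: "D * D = D"
  shows "A * A = A"
proof -
  obtain P Q where wit: "similar_mat_wit A D P Q"
    using sim by (auto simp: similar_mat_def)
  define n where "n = dim_row A"
  note w = similar_mat_witD[OF n_def wit]
  have "D ^\<^sub>m 2 = D"
    using idem w(5) by (simp add: numeral_2_eq_2)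
  then have "A ^\<^sub>m 2 = A"
    \<comment> \<open>The same \<open>P\<close> and \<open>Q\<close> witness the similarity of the
      squares, so \<open>A ^\<^sub>m 2\<close> is \<open>P * D ^\<^sub>m 2 * Q = P * D * Q\<close>,
      which is \<open>A\<close>.\<close>
    using similar_mat_witD(3)[OF _ similar_mat_wit_pow[OF wit, of 2]] w(3) by simp
  then show ?thesis
    using w(4) by (simp add: numeral_2_eq_2)
qed

theorem corollary13:
  fixes A :: "bit mat"
  assumes "A \<in> carrier_mat 2 2"
    and "\<exists>D \<in> carrier_mat 2 2. diagonal_mat D \<and> similar_mat A D"
  shows "\<exists>B \<in> carrier_mat 2 2. B ^\<^sub>m 2 = A"
proof -
  have "A * A = A"
    using assms(2) diagonal_mat_bit_idempotent similar_mat_idempotent by blast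
  then have "A ^\<^sub>m 2 = A"
    using assms(1) by (simp add: numeral_2_eq_2)
  with assms(1) show ?thesis by blast
qed

end
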